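(* Let $F\colon\mathbb{R}^n\rightrightarrows\mathbb{R}^p$ be a set-valued mapping with convex graph, let $\varphi\colon\mathbb{R}^n\times\mathbb{R}^p\to(-\infty,\infty]$ be a convex function, and let $$\mu(x):=\inf\{\varphi(x,y) : y\in F(x)\},\quad x\in\mathbb{R}^n.$$ Suppose that $\mu(x)>-\infty$ for all $x\in\mathbb{R}^n$, fix $\bar{x}\in\mathrm{dom}(\mu)$, and consider the solution set $$S(\bar{x}):=\{\bar{y}\in F(\bar{x}) : \mu(\bar{x})=\varphi(\bar{x},\bar{y})\}.$$ If $S(\bar{x})\neq\emptyset$, then for any $\bar{y}\in S(\bar{x})$ we have $$\partial\mu(\bar{x})=\bigcup_{(u,v)\in\partial\varphi(\bar{x},\bar{y})}\big[u+D^*F(\bar{x},\bar{y})(v)\big]$$ provided that $$\mathrm{ri}(\mathrm{dom}(\varphi))\cap\mathrm{ri}(\mathrm{gph}(F))\neq\emptyset.$$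
   Context: A set-valued mapping $F\colon\mathbb{R}^n\rightrightarrows\mathbb{R}^p$ assigns to each $x$ a set $F(x)\subset\mathbb{R}^p$ (possibly empty); $\mathrm{gph}(F):=\{(x,y) : y\in F(x)\}$. By convention $\inf\emptyset=\infty$. For an extended-real-valued function, $\mathrm{dom}(f):=\{x : f(x)<\infty\}$. For a convex function $f$ and $\bar{x}\in\mathrm{dom}(f)$, $\partial f(\bar{x}):=\{v : f(x)\ge f(\bar{x})+\langle v,x-\bar{x}\rangle\text{ for all }x\}$. For a convex set $\Omega$ and $\bar{x}\in\Omega$, the normal cone is $N(\bar{x};\Omega):=\{v : \langle v,x-\bar{x}\rangle\le 0\text{ for all }x\in\Omega\}$. The coderivative of $F$ at $(\bar{x},\bar{y})\in\mathrm{gph}(F)$ is $D^*F(\bar{x},\bar{y})(v):=\{u\in\mathbb{R}^n : (u,-v)\in N((\bar{x},\bar{y});\mathrm{gph}(F))\}$, $v\in\mathbb{R}^p$. The relative interior $\mathrm{ri}(\Omega)$ of a convex set $\Omega$ is the set of $x\in\Omega$ for which there is $\gamma>0$ with $\mathbb{B}(x;\gamma)\cap\mathrm{aff}(\Omega)\subset\Omega$ (closed ball, affine hull). *)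

theory Defs
  imports "HOL-Analysis.Analysis"
begin

definition eff_domain :: "('a \<Rightarrow> ereal) \<Rightarrow> 'a set" where
  "eff_domain f = {x. f x < \<infinity>}"

(* Jensen's inequality; only meant for f with values in (-\<infinity>, \<infinity>], where no sum
   \<infinity> - \<infinity> arises on the right. Weights 0 and 1 are excluded, where the inequality is trivial. *)
definition ereal_convex :: "('a::real_vector \<Rightarrow> ereal) \<Rightarrow> bool" where
  "ereal_convex f \<longleftrightarrow>
     (\<forall>x y t. 0 < t \<and> t < 1 \<longrightarrow>
        f ((1 - t) *\<^sub>R x + t *\<^sub>R y) \<le> ereal (1 - t) * f x + ereal t * f y)"

definition subdifferential :: "('a::real_inner \<Rightarrow> ereal) \<Rightarrow> 'a \<Rightarrow> 'a set" where
  "subdifferential f xb = {v. \<forall>x. f x \<ge> f xb + ereal (v \<bullet> (x - xb))}"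

definition normal_cone :: "'a::real_inner \<Rightarrow> 'a set \<Rightarrow> 'a set" where
  "normal_cone xb \<Omega> = {v. \<forall>x\<in>\<Omega>. v \<bullet> (x - xb) \<le> 0}"

definition gph :: "('a \<Rightarrow> 'b set) \<Rightarrow> ('a \<times> 'b) set" where
  "gph F = {(x, y). y \<in> F x}"

definition coderivative ::
  "('a::real_inner \<Rightarrow> 'b::real_inner set) \<Rightarrow> 'a \<Rightarrow> 'b \<Rightarrow> 'b \<Rightarrow> 'a set" where
  "coderivative F xb yb v = {u. (u, - v) \<in> normal_cone (xb, yb) (gph F)}"

(* Infimum in ereal, so the value is \<infinity> where F x is empty. *)
definition optimal_value :: "('a \<times> 'b \<Rightarrow> ereal) \<Rightarrow> ('a \<Rightarrow> 'b set) \<Rightarrow> 'a \<Rightarrow> ereal" where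
  "optimal_value \<phi> F x = Inf {\<phi> (x, y) | y. y \<in> F x}"

definition solution_set :: "('a \<times> 'b \<Rightarrow> ereal) \<Rightarrow> ('a \<Rightarrow> 'b set) \<Rightarrow> 'a \<Rightarrow> 'b set" where
  "solution_set \<phi> F x = {y \<in> F x. optimal_value \<phi> F x = \<phi> (x, y)}"

end

theory Submission
  imports Defs
begin

text \<open>
  Since \<open>yb\<close> attains the infimum defining the optimal value at \<open>xb\<close>, a vector \<open>w\<close> is a subgradient of
  the optimal value at \<open>xb\<close> exactly when \<open>(w, 0)\<close> is a subgradient of \<open>\<phi>\<close> at \<open>(xb, yb)\<close>, tested only
  against points of the graph of \<open>F\<close> (lemma \<open>subdifferential_optimal_value_iff\<close>). In other words,
  \<open>(w, 0)\<close> is a subgradient of \<open>\<phi>\<close> plus the indicator function of the graph, and the theorem is the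
  subdifferential sum rule for these two functions: \<open>(w, 0) = (u, v) + (w - u, - v)\<close> with \<open>(u, v)\<close> a
  subgradient of \<open>\<phi>\<close> and \<open>(w - u, - v)\<close> normal to the graph, the latter meaning that \<open>w - u\<close> lies in
  the coderivative at \<open>v\<close>. That such sums are subgradients follows by adding two inequalities; all
  the content is in the splitting.

  The splitting (lemma \<open>subgradient_on_convex_set_decompose\<close>, for a convex function \<open>f\<close> and a convex
  set \<open>D\<close>) comes from separating two disjoint convex sets in the product with the real line: the
  strict epigraph of \<open>f\<close>, and the graph over \<open>D\<close> of the affine minorant given by the subgradient.
  A separating hyperplane that is not vertical is the graph of an affine function squeezed between
  the two, and its slope is the subgradient of \<open>f\<close> sought. The relative interior condition excludes
  vertical hyperplanes, provided that the separation is proper (lemma \<open>proper_separation_origin\<close>):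
  a vertical one would separate the domain of \<open>f\<close> from \<open>D\<close>, hence be constant on both, because they
  share a relative interior point (lemma \<open>linear_const_if_min_in_rel_interior\<close>).
\<close>

text \<open>
  From any point of \<open>S\<close> the segment to \<open>z\<close> can be prolonged a little beyond \<open>z\<close> inside \<open>S\<close>. If the
  functional decreased towards \<open>z\<close>, it would fall below its minimum on that prolongation.
\<close>
lemma linear_const_if_min_in_rel_interior:
  fixes S :: "'a::euclidean_space set"
  assumes "convex S" and z: "z \<in> rel_interior S"
    and min: "\<And>x. x \<in> S \<Longrightarrow> a \<bullet> z \<le> a \<bullet> x" and x: "x \<in> S"
  shows "a \<bullet> x = a \<bullet> z"
proof -
  obtain e where "e > 1" and e: "(1 - e) *\<^sub>R x + e *\<^sub>R z \<in> S"
    using convex_rel_interior_if[OF \<open>convex S\<close> z] hull_inc[OF x, of affine] by force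
  have "a \<bullet> z \<le> (1 - e) * (a \<bullet> x) + e * (a \<bullet> z)"
    using min[OF e] by (simp add: inner_add_right)
  then have "(e - 1) * (a \<bullet> x) \<le> (e - 1) * (a \<bullet> z)"
    by (simp add: algebra_simps)
  with \<open>e > 1\<close> have "a \<bullet> x \<le> a \<bullet> z"
    by simp
  with min[OF x] show ?thesis
    by simp
qed

text \<open>
  The separating vector can be chosen in the span of \<open>K\<close>. Being nonzero, it is then not orthogonal
  to all of \<open>K\<close>, so that \<open>K\<close> does not lie inside the separating hyperplane.
\<close>
lemma proper_separation_origin:
  fixes K :: "'a::euclidean_space set"
  assumes "convex K" "K \<noteq> {}" "0 \<notin> K"
  obtains a k where "\<And>x. x \<in> K \<Longrightarrow> 0 \<le> a \<bullet> x" "k \<in> K" "0 < a \<bullet> k"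
proof -
  obtain a where a: "a \<in> span K" "a \<noteq> 0" and nonneg: "\<And>x. x \<in> K \<Longrightarrow> 0 \<le> a \<bullet> x"
    using separating_hyperplane_set_0_inspan[OF assms] by blast
  have "\<exists>k\<in>K. a \<bullet> k \<noteq> 0"
  proof (rule ccontr)
    assume "\<not> ?thesis"
    then have "orthogonal a a"
      using orthogonal_to_span[OF a(1), of a] by (auto simp: orthogonal_def)
    with a(2) show False
      by (simp add: orthogonal_self)
  qed
  with nonneg that show thesis
    by (metis order_le_less)
qed

lemma convex_strict_epigraph:
  assumes "ereal_convex f" and proper: "\<And>x. f x > -\<infinity>"
  shows "convex {(x, r). f x < ereal r}"
proof (rule convexI)
  fix X Y and s t :: real
  assume X: "X \<in> {(x, r). f x < ereal r}" and Y: "Y \<in> {(x, r). f x < ereal r}"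
    and st: "0 \<le> s" "0 \<le> t" "s + t = 1"
  show "s *\<^sub>R X + t *\<^sub>R Y \<in> {(x, r). f x < ereal r}"
  proof (cases "s = 0 \<or> t = 0")
    case True
    with X Y st show ?thesis by auto
  next
    case False
    obtain x a y b where XY: "X = (x, a)" "Y = (y, b)"
      by (metis surj_pair)
    obtain c where c: "f x = ereal c" "c < a"
      using X XY proper[of x] by (cases "f x") auto
    obtain d where d: "f y = ereal d" "d < b"
      using Y XY proper[of y] by (cases "f y") auto
    have s: "s = 1 - t" "0 < t" "t < 1"
      using st False by auto
    have "f (s *\<^sub>R x + t *\<^sub>R y) \<le> ereal s * f x + ereal t * f y"
      using assms(1) s unfolding ereal_convex_def by blast
    also have "\<dots> = ereal (s * c + t * d)"
      by (simp add: c d)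
    also have "\<dots> < ereal (s * a + t * b)"
      using c d st False by (simp add: add_strict_mono)
    finally show ?thesis
      by (simp add: XY)
  qed
qed

text \<open>
  The nontrivial half of the sum rule for \<open>f\<close> and the indicator function of \<open>D\<close>. Separation yields a
  functional \<open>(a, c)\<close> with \<open>a \<bullet> (z - z') + c * (r - (f zb + p \<bullet> (z' - zb))) \<ge> 0\<close> whenever \<open>f z < r\<close> and
  \<open>z' \<in> D\<close>. Once \<open>c > 0\<close> is known, divide by \<open>c\<close> and put \<open>q = - a / c\<close>: the choice \<open>z' = zb\<close> makes \<open>q\<close> a
  subgradient of \<open>f\<close>, and the choice \<open>z = zb\<close> makes \<open>p - q\<close> normal to \<open>D\<close>.
\<close>
lemma subgradient_on_convex_set_decompose:
  fixes f :: "'a::euclidean_space \<Rightarrow> ereal"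
  assumes f: "ereal_convex f" "\<And>z. f z > -\<infinity>" and "convex D"
    and ri: "rel_interior (eff_domain f) \<inter> rel_interior D \<noteq> {}"
    and zb: "zb \<in> D" "f zb < \<infinity>"
    and p: "\<And>z. z \<in> D \<Longrightarrow> f z \<ge> f zb + ereal (p \<bullet> (z - zb))"
  obtains q where "q \<in> subdifferential f zb" "p - q \<in> normal_cone zb D"
proof -
  obtain m where m: "f zb = ereal m"
    using zb(2) f(2)[of zb] by (cases "f zb") auto
  \<comment> \<open>The strict epigraph \<open>E\<close> and the graph \<open>G\<close> of the affine minorant are disjoint; separating them
      amounts to separating the origin from their set of differences \<open>K\<close>.\<close>
  define E where "E = {(z, r). f z < ereal r}"
  define G where "G = (\<lambda>z. (z, m + p \<bullet> (z - zb))) ` D"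
  define K where "K = (\<Union>X\<in>E. \<Union>Y\<in>G. {X - Y})"
  have K: "(z - z', r - (m + p \<bullet> (z' - zb))) \<in> K" if "f z < ereal r" "z' \<in> D" for z z' r
    using that unfolding K_def E_def G_def by force
  have "convex E"
    unfolding E_def using f by (rule convex_strict_epigraph)
  have "eff_domain f = fst ` E"
  proof (intro equalityI subsetI)
    fix z assume "z \<in> eff_domain f"
    then show "z \<in> fst ` E"
      using less_PInf_Ex_of_nat[of "f z"] unfolding eff_domain_def E_def by force
  next
    fix z assume "z \<in> fst ` E"
    then show "z \<in> eff_domain f"
      unfolding eff_domain_def E_def by (auto intro: less_trans)
  qed
  then have "convex (eff_domain f)"
    using \<open>convex E\<close> convex_linear_image linear_fst by metis
  have "convex G"
    unfolding G_def
  proof (rule convexI, clarify)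
    fix x y and s t :: real
    assume xy: "x \<in> D" "y \<in> D" and st: "0 \<le> s" "0 \<le> t" "s + t = 1"
    have "s *\<^sub>R (x, m + p \<bullet> (x - zb)) + t *\<^sub>R (y, m + p \<bullet> (y - zb))
        = (s *\<^sub>R x + t *\<^sub>R y, m + p \<bullet> (s *\<^sub>R x + t *\<^sub>R y - zb))"
    proof -
      have s: "s = 1 - t" using st by simp
      show ?thesis unfolding s
        by (simp add: inner_add_right inner_diff_right algebra_simps)
    qed
    moreover have "s *\<^sub>R x + t *\<^sub>R y \<in> D"
      using \<open>convex D\<close> xy st by (simp add: convexD)
    ultimately show "s *\<^sub>R (x, m + p \<bullet> (x - zb)) + t *\<^sub>R (y, m + p \<bullet> (y - zb))
        \<in> (\<lambda>z. (z, m + p \<bullet> (z - zb))) ` D"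
      by (simp add: image_iff)
  qed
  have "convex K"
    unfolding K_def by (rule convex_differences) fact+
  moreover have "K \<noteq> {}"
    using K[of zb "m + 1" zb] m zb(1) by auto
  moreover have "0 \<notin> K"
  proof
    assume "0 \<in> K"
    then obtain z where "z \<in> D" "f z < ereal (m + p \<bullet> (z - zb))"
      unfolding K_def E_def G_def by (auto simp: zero_prod_def)
    with p[of z] m show False
      by simp
  qed
  ultimately obtain h k where h: "\<And>X. X \<in> K \<Longrightarrow> 0 \<le> h \<bullet> X" and k: "k \<in> K" "0 < h \<bullet> k"
    by (rule proper_separation_origin) blast
  obtain a c where ac: "h = (a, c)"
    by (metis surj_pair)
  have sep: "0 \<le> a \<bullet> (z - z') + c * (r - (m + p \<bullet> (z' - zb)))"
    if "f z < ereal r" "z' \<in> D" for z z' r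
    using h[OF K[OF that]] by (simp add: ac)
  \<comment> \<open>Above \<open>zb\<close> the sets \<open>E\<close> and \<open>G\<close> differ by a purely vertical upward vector.\<close>
  have "0 \<le> c"
    using sep[of zb "m + 1" zb] m zb(1) by simp
  \<comment> \<open>For \<open>c = 0\<close> the functional \<open>a\<close> would be constant on the domain of \<open>f\<close> and on \<open>D\<close>, with the same
      value, so the separation would not be proper.\<close>
  have "c \<noteq> 0"
  proof
    assume "c = 0"
    have le: "a \<bullet> z' \<le> a \<bullet> z" if z: "z \<in> eff_domain f" and "z' \<in> D" for z z'
    proof -
      obtain r where "f z < ereal r"
        using z \<open>eff_domain f = fst ` E\<close> E_def by auto
      then show ?thesis
        using sep[of z r z'] \<open>z' \<in> D\<close> \<open>c = 0\<close> by (simp add: inner_diff_right)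
    qed
    obtain z0 where z0: "z0 \<in> rel_interior (eff_domain f)" "z0 \<in> rel_interior D"
      using ri by blast
    then have z0': "z0 \<in> eff_domain f" "z0 \<in> D"
      using rel_interior_subset by auto
    have dom: "a \<bullet> z = a \<bullet> z0" if "z \<in> eff_domain f" for z
      using linear_const_if_min_in_rel_interior[OF \<open>convex (eff_domain f)\<close> z0(1) _ that, of a] le z0'
      by blast
    have D: "a \<bullet> z = a \<bullet> z0" if "z \<in> D" for z
      using linear_const_if_min_in_rel_interior[OF \<open>convex D\<close> z0(2) _ that, of "- a"] le z0'
      by simp
    obtain z r z' where kz: "f z < ereal r" "z' \<in> D" "k = (z - z', r - (m + p \<bullet> (z' - zb)))"
      using k(1) unfolding K_def E_def G_def by auto
    then have "z \<in> eff_domain f"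
      unfolding eff_domain_def by (auto intro: less_trans)
    then have "h \<bullet> k = 0"
      using dom[of z] D[OF kz(2)] \<open>c = 0\<close> by (simp add: ac kz(3) inner_diff_right)
    with k(2) show False
      by simp
  qed
  with \<open>0 \<le> c\<close> have "c > 0"
    by simp
  define q where "q = (- 1 / c) *\<^sub>R a"
  have a: "a = - (c *\<^sub>R q)"
    using \<open>c > 0\<close> by (simp add: q_def)
  \<comment> \<open>The limit from \<open>f z < r\<close> to \<open>f z \<le> r\<close> allows \<open>r\<close> to be the value \<open>f z\<close> itself.\<close>
  have key: "q \<bullet> (z - z') + (m + p \<bullet> (z' - zb)) \<le> r" if "f z \<le> ereal r" "z' \<in> D" for z z' r
  proof (rule dense_ge)
    fix r' assume "r < r'"
    with that(1) have "f z < ereal r'"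
      by (simp add: le_less_trans)
    from sep[OF this that(2)]
    have "0 \<le> c * (r' - (m + p \<bullet> (z' - zb)) - q \<bullet> (z - z'))"
      unfolding a by (simp add: algebra_simps)
    then show "q \<bullet> (z - z') + (m + p \<bullet> (z' - zb)) \<le> r'"
      using \<open>c > 0\<close> by (simp add: zero_le_mult_iff)
  qed
  have "q \<in> subdifferential f zb"
    unfolding subdifferential_def
  proof (clarify)
    fix z
    show "f z \<ge> f zb + ereal (q \<bullet> (z - zb))"
    proof (cases "f z")
      case (real r)
      with key[of z r zb] zb(1) m show ?thesis
        by simp
    qed (use f(2)[of z] in auto)
  qed
  moreover have "p - q \<in> normal_cone zb D"
    unfolding normal_cone_def
  proof (clarify)
    fix z assume "z \<in> D"
    then show "(p - q) \<bullet> (z - zb) \<le> 0"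
      using key[of zb m z] m by (simp add: inner_diff_left inner_diff_right)
  qed
  ultimately show thesis
    by (rule that)
qed

text \<open>
  A lower bound for an infimum is a lower bound for each of its members; over all \<open>x\<close> at once, these
  members are the values of \<open>\<phi>\<close> on the graph of \<open>F\<close>. The zero second component records that the bound
  does not depend on the decision variable \<open>y\<close>.
\<close>
lemma subdifferential_optimal_value_iff:
  assumes "yb \<in> solution_set \<phi> F xb"
  shows "w \<in> subdifferential (optimal_value \<phi> F) xb \<longleftrightarrow>
    (\<forall>z\<in>gph F. \<phi> z \<ge> \<phi> (xb, yb) + ereal ((w, 0) \<bullet> (z - (xb, yb))))"
proof -
  have "optimal_value \<phi> F xb = \<phi> (xb, yb)"
    using assms unfolding solution_set_def by simp
  then show ?thesis
    unfolding subdifferential_def optimal_value_def gph_def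
    by (auto simp: le_Inf_iff)
qed

theorem theorem9p1:
  fixes F :: "real ^ 'n \<Rightarrow> (real ^ 'p) set"
    and \<phi> :: "(real ^ 'n) \<times> (real ^ 'p) \<Rightarrow> ereal"
    and xb :: "real ^ 'n" and yb :: "real ^ 'p"
  assumes "convex (gph F)"
    and "\<And>z. \<phi> z > -\<infinity>" and "ereal_convex \<phi>"
    and "\<And>x. optimal_value \<phi> F x > -\<infinity>"
    and "xb \<in> eff_domain (optimal_value \<phi> F)"
    and "yb \<in> solution_set \<phi> F xb"
    and "rel_interior (eff_domain \<phi>) \<inter> rel_interior (gph F) \<noteq> {}"
  shows "subdifferential (optimal_value \<phi> F) xb =
    (\<Union>(u, v)\<in>subdifferential \<phi> (xb, yb). (\<lambda>w. u + w) ` coderivative F xb yb v)"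
proof -
  have zb: "(xb, yb) \<in> gph F" "\<phi> (xb, yb) < \<infinity>"
    using assms(5,6) by (auto simp: gph_def solution_set_def eff_domain_def)
  have "w \<in> (\<Union>(u, v)\<in>subdifferential \<phi> (xb, yb). (\<lambda>w. u + w) ` coderivative F xb yb v)"
    if "w \<in> subdifferential (optimal_value \<phi> F) xb" for w
  proof -
    have "\<phi> z \<ge> \<phi> (xb, yb) + ereal ((w, 0) \<bullet> (z - (xb, yb)))" if "z \<in> gph F" for z
      using \<open>w \<in> _\<close> that subdifferential_optimal_value_iff[OF assms(6)] by blast
    then obtain q where q: "q \<in> subdifferential \<phi> (xb, yb)"
      "(w, 0) - q \<in> normal_cone (xb, yb) (gph F)"
      using subgradient_on_convex_set_decompose[OF assms(3,2,1,7) zb] by blast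
    obtain u v where uv: "q = (u, v)"
      by (metis surj_pair)
    with q(2) have "w - u \<in> coderivative F xb yb v"
      by (simp add: coderivative_def)
    moreover have "w = u + (w - u)"
      by simp
    ultimately show ?thesis
      using q(1) unfolding uv by blast
  qed
  moreover have "u + t \<in> subdifferential (optimal_value \<phi> F) xb"
    if uv: "(u, v) \<in> subdifferential \<phi> (xb, yb)" and t: "t \<in> coderivative F xb yb v" for u v t
    unfolding subdifferential_optimal_value_iff[OF assms(6)]
  proof
    fix z assume "z \<in> gph F"
    have "(u, v) \<bullet> (z - (xb, yb)) = (u + t, 0) \<bullet> (z - (xb, yb)) - (t, - v) \<bullet> (z - (xb, yb))"
      by (simp flip: inner_diff_left)
    moreover have "(t, - v) \<bullet> (z - (xb, yb)) \<le> 0"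
      using t \<open>z \<in> gph F\<close> unfolding coderivative_def normal_cone_def by blast
    ultimately have "\<phi> (xb, yb) + ereal ((u + t, 0) \<bullet> (z - (xb, yb)))
        \<le> \<phi> (xb, yb) + ereal ((u, v) \<bullet> (z - (xb, yb)))"
      by (intro add_left_mono) simp
    also have "\<dots> \<le> \<phi> z"
      using uv unfolding subdifferential_def by blast
    finally show "\<phi> z \<ge> \<phi> (xb, yb) + ereal ((u + t, 0) \<bullet> (z - (xb, yb)))" .
  qed
  ultimately show ?thesis
    by auto
qed

end
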